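(* Let $b,p,c\in\mathbb{C}$ with $c\neq 0$, let $\kappa=p+(b+1)/2$, and suppose that $$\sqrt{3}\,|\kappa-2|+\frac{|c|}{4}<\sqrt{\frac{9}{8}+\frac{1}{\sqrt{2}}}.$$ Then the generalized and "normalized" Bessel function $u_p(z)=u_{p,b,c}(z)=\sum_{n\ge 0}\frac{(-c/4)^n}{(\kappa)_n}\frac{z^n}{n!}$ is lemniscate convex in $\mathbb{D}$.
   Context: $\mathbb{D}=\{z\in\mathbb{C}:|z|<1\}$. For analytic functions $f,g$ on $\mathbb{D}$, $f\prec g$ ($f$ is subordinate to $g$) means that there is an analytic $w:\mathbb{D}\to\mathbb{D}$ with $w(0)=0$ and $f=g\circ w$. $\sqrt{1+z}$ denotes the principal branch (value $1$ at $z=0$). An analytic function $f$ on $\mathbb{D}$ is called lemniscate convex if $1+\frac{zf''(z)}{f'(z)}$ is analytic in $\mathbb{D}$ ($f'$ having no zeros there) and $1+\frac{zf''(z)}{f'(z)}\prec\sqrt{1+z}$. This is applied to $u_p$ even though $u_p$ is not normalized by $f(0)=0$, $f'(0)=1$; the condition is unchanged by replacing $f$ with $(f-f(0))/f'(0)$. $(\lambda)_n=\lambda(\lambda+1)\cdots(\lambda+n-1)$, $(\lambda)_0=1$, is the Pochhammer symbol. The function $u_p$ is defined for $\kappa\neq 0,-1,-2,\ldots$ and is entire. *)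

theory Defs
  imports "HOL-Complex_Analysis.Complex_Analysis"
begin

abbreviation unit_disc :: "complex set" where
  "unit_disc \<equiv> ball 0 1"

definition subordinate :: "(complex \<Rightarrow> complex) \<Rightarrow> (complex \<Rightarrow> complex) \<Rightarrow> bool" where
  "subordinate f g \<longleftrightarrow>
     f analytic_on unit_disc \<and> g analytic_on unit_disc \<and>
     (\<exists>w. w analytic_on unit_disc \<and> w ` unit_disc \<subseteq> unit_disc \<and> w 0 = 0 \<and>
          (\<forall>z\<in>unit_disc. f z = g (w z)))"

text \<open>No normalization \<open>f 0 = 0\<close>, \<open>deriv f 0 = 1\<close> is imposed: the condition is invariant under
  replacing \<open>f\<close> by \<open>(f - f 0) / deriv f 0\<close>.  The explicit non-vanishing of \<open>deriv f\<close> is needed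
  because division by zero is total in HOL.\<close>

definition lemniscate_convex :: "(complex \<Rightarrow> complex) \<Rightarrow> bool" where
  "lemniscate_convex f \<longleftrightarrow>
     f analytic_on unit_disc \<and>
     (\<forall>z\<in>unit_disc. deriv f z \<noteq> 0) \<and>
     (\<lambda>z. 1 + z * deriv (deriv f) z / deriv f z) analytic_on unit_disc \<and>
     subordinate (\<lambda>z. 1 + z * deriv (deriv f) z / deriv f z) (\<lambda>z. csqrt (1 + z))"

text \<open>Meaningful only if \<open>\<kappa> = p + (b + 1) / 2\<close> is not one of \<open>0, -1, -2, \<dots>\<close>; otherwise some
  \<open>pochhammer \<kappa> n\<close> vanish.\<close>

definition gen_bessel :: "complex \<Rightarrow> complex \<Rightarrow> complex \<Rightarrow> complex \<Rightarrow> complex" where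
  "gen_bessel p b c z =
     (\<Sum>n. (- c / 4) ^ n / pochhammer (p + (b + 1) / 2) n * (z ^ n / fact n))"

end

theory Submission
  imports Defs
begin

text \<open>The function \<open>P = 1 + z u'' / u'\<close> solves the Riccati equation
  \<open>z P' + P\<^sup>2 - 1 + (\<kappa> - 2) (P - 1) + c z / 4 = 0\<close>.  Suppose that \<open>P\<close> leaves the right half of the
  lemniscate \<open>\<bar>P\<^sup>2 - 1\<bar> < 1\<close>, and let \<open>z\<^sub>0\<close> be a point of least modulus where it does.  Jack's lemma
  for \<open>w = P\<^sup>2 - 1\<close> gives \<open>z\<^sub>0 w'(z\<^sub>0) = m w(z\<^sub>0)\<close> with \<open>m \<ge> 1\<close>, so that
  \<open>\<bar>z\<^sub>0 P' + P\<^sup>2 - 1\<bar> = \<bar>1 + m / (2 P)\<bar> \<ge> sqrt (9/8 + 1 / sqrt 2)\<close>, while \<open>\<bar>P - 1\<bar> \<le> sqrt 3\<close> there: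
  this contradicts the hypothesis.  That \<open>u'\<close> has no zeros follows from a termwise comparison of its
  power series with the exponential series.\<close>

section \<open>Jack's lemma at a boundary point\<close>

lemma nonneg_real_of_halfplane:
  fixes d :: complex
  assumes "\<And>s. Re s < 0 \<Longrightarrow> Re (d * s) \<le> 0"
  shows "Im d = 0" "Re d \<ge> 0"
proof -
  show "Im d = 0"
  proof (rule ccontr)
    assume "Im d \<noteq> 0"
    \<comment> \<open>The imaginary part of the witness is scaled by \<open>1 / Im d\<close> so that
      its contribution, \<open>\<bar>Re d\<bar> + 1\<close>, outweighs
      \<open>- Re d\<close>.\<close>
    then have "Re (d * Complex (-1) (- (\<bar>Re d\<bar> + 1) / Im d)) = - Re d + \<bar>Re d\<bar> + 1"
      by (simp add: field_simps)
    with assms[of "Complex (-1) (- (\<bar>Re d\<bar> + 1) / Im d)"] show False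
      by simp
  qed
  show "Re d \<ge> 0"
    using assms[of "-1"] by simp
qed

text \<open>After rescaling to \<open>g\<close> on the unit disc with \<open>g 1 = 1\<close>,
  Schwarz gives |g \<zeta>| \<le> |\<zeta>|, so Re (g \<zeta> / \<zeta>) is at most 1 in the disc
  and equals 1 at \<zeta> = 1. Its derivative there therefore cannot be positive in any direction
  \<open>s\<close> pointing into the disc, that is, with Re s < 0. This forces the complex
  derivative \<open>d\<close> of g \<zeta> / \<zeta> at 1 to be real and nonnegative, and m = 1 +
  d.\<close>

lemma Jack_lemma:
  fixes w :: "complex \<Rightarrow> complex"
  assumes hol: "w holomorphic_on S" and S: "open S" "cball 0 (cmod z0) \<subseteq> S"
    and "w 0 = 0" "z0 \<noteq> 0"
    and less: "\<And>z. cmod z < cmod z0 \<Longrightarrow> cmod (w z) < cmod (w z0)"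
  obtains m :: real where "m \<ge> 1" "z0 * deriv w z0 = of_real m * w z0"
proof -
  have w0: "w z0 \<noteq> 0"
    using less[of 0] \<open>z0 \<noteq> 0\<close> by auto
  define g where "g = (\<lambda>\<zeta>. w (z0 * \<zeta>) / w z0)"
  have schwarz: "cmod (g \<zeta>) \<le> cmod \<zeta>" if "cmod \<zeta> < 1" for \<zeta>
  proof (rule Schwarz_Lemma(1)[OF _ _ _ that])
    show "g holomorphic_on ball 0 1"
      unfolding g_def
    proof (rule holomorphic_on_divide[OF holomorphic_on_compose_gen[OF _ hol, unfolded o_def]])
      show "(*) z0 ` ball 0 1 \<subseteq> S"
      proof safe
        fix x :: complex assume "x \<in> ball 0 1"
        then have "cmod (z0 * x) \<le> cmod z0"
          by (simp add: norm_mult mult_left_le)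
        then show "z0 * x \<in> S" using S(2) by auto
      qed
    qed (use w0 in \<open>auto intro: holomorphic_intros\<close>)
    show "g 0 = 0" using \<open>w 0 = 0\<close> by (simp add: g_def)
    show "cmod (g z) < 1" if "cmod z < 1" for z
    proof -
      have "cmod (z0 * z) < cmod z0"
        using that \<open>z0 \<noteq> 0\<close> by (simp add: norm_mult)
      from less[OF this] show ?thesis
        using w0 by (simp add: g_def norm_divide field_simps)
    qed
  qed
  define d where "d = z0 * deriv w z0 / w z0 - 1"
  \<comment> \<open>Writing the point as \<open>z0 * 1\<close> lets the chain rule be applied at
    \<zeta> = 1.\<close>
  have "(w has_field_derivative deriv w z0) (at (z0 * 1))"
    using hol S by (auto intro: holomorphic_derivI)
  then have "((\<lambda>\<zeta>. w (z0 * \<zeta>)) has_field_derivative deriv w z0 * z0) (at 1)"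
    by (rule DERIV_chain2) (auto intro!: derivative_eq_intros)
  then have dg: "((\<lambda>\<zeta>. g \<zeta> / \<zeta>) has_field_derivative d) (at 1)"
    unfolding g_def using w0 by (auto intro!: derivative_eq_intros simp: d_def field_simps)
  have "Re (d * s) \<le> 0" if s: "Re s < 0" for s
  proof (rule ccontr)
    assume neg: "\<not> Re (d * s) \<le> 0"
    define h where "h = (\<lambda>t::real. Re (g (1 + of_real t * s) / (1 + of_real t * s)))"
    have line: "((\<lambda>t::real. 1 + of_real t * s) has_vector_derivative s) (at 0)"
      by (auto intro!: derivative_eq_intros)
    have "((\<lambda>t. g (1 + of_real t * s) / (1 + of_real t * s)) has_vector_derivative s * d) (at 0)"
      using field_vector_diff_chain_at[OF line, of "\<lambda>\<zeta>. g \<zeta> / \<zeta>" d] dg by (simp add: o_def)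
    then have "(h has_real_derivative Re (s * d)) (at 0)"
      unfolding h_def has_real_derivative_iff_has_vector_derivative
      by (rule bounded_linear.has_vector_derivative[OF bounded_linear_Re])
    then obtain e where e: "e > 0" "\<And>t. 0 < t \<Longrightarrow> t < e \<Longrightarrow> h 0 < h t"
      using DERIV_pos_inc_right[of h "Re (s * d)" 0] neg by (auto simp: mult.commute)
    have h0: "h 0 = 1" using w0 by (simp add: h_def g_def)
    have h_le: "h t \<le> 1" if "cmod (1 + of_real t * s) < 1" for t
    proof -
      have "h t \<le> cmod (g (1 + of_real t * s)) / cmod (1 + of_real t * s)"
        unfolding h_def by (metis complex_Re_le_cmod norm_divide)
      \<comment> \<open>If the denominator vanishes, the quotient is 0 and the bound still
        holds.\<close>
      also have "\<dots> \<le> 1"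
        using schwarz[OF that] by (simp add: divide_le_eq_1)
      finally show ?thesis .
    qed
    have s0: "cmod s > 0" using s by auto
    \<comment> \<open>Since |1 + t s|^2 = 1 + t (2 Re s + t |s|^2), the segment stays in the disc
      for t < -2 Re s / |s|^2. Half of that bound is taken, and e / 2 keeps t in the range where
      \<open>h\<close> exceeds \<open>h 0\<close>.\<close>
    define t where "t = min (e / 2) (- Re s / (cmod s)\<^sup>2)"
    have "- Re s / (cmod s)\<^sup>2 > 0" using s s0 by (intro divide_pos_pos) auto
    with e(1) have t: "0 < t" "t < e" unfolding t_def by linarith+
    have "t * (cmod s)\<^sup>2 \<le> - Re s"
      using s0 by (simp add: t_def min_def field_simps)
    then have "t * (t * (cmod s)\<^sup>2 + 2 * Re s) < 0"
      using t(1) s by (intro mult_pos_neg) auto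
    then have "(cmod (1 + of_real t * s))\<^sup>2 < 1\<^sup>2"
      unfolding cmod_power2 by (simp add: algebra_simps power2_eq_square)
    then have "cmod (1 + of_real t * s) < 1"
      by (rule power_less_imp_less_base) simp
    with h_le[of t] e(2)[OF t] h0 show False by simp
  qed
  from nonneg_real_of_halfplane[of d, OF this]
  have "Im d = 0" "Re d \<ge> 0" by auto
  then have "d = of_real (Re d)" by (simp add: complex_eq_iff)
  then have "z0 * deriv w z0 / w z0 = of_real (1 + Re d)"
    by (simp add: d_def)
  then have "z0 * deriv w z0 = of_real (1 + Re d) * w z0"
    using w0 by (simp add: field_simps)
  with \<open>Re d \<ge> 0\<close> show thesis by (intro that[of "1 + Re d"]) auto
qed

section \<open>The Riccati equation and the lemniscate\<close>

text \<open>On the lemniscate \<rho> = |P|^2 satisfies \<rho>^2 = 2 Re (P^2), whence Re (1 / P)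
  \<ge> 1 / sqrt 2 and \<rho> \<le> 2. The squared modulus expands to 1 + m Re (1 / P) + m^2 / (4
  \<rho>), and each term is estimated with m \<ge> 1. Equality occurs at P = sqrt 2, m = 1.\<close>

lemma lemniscate_boundary_bound:
  fixes P :: complex
  assumes "cmod (P\<^sup>2 - 1) = 1" "Re P \<ge> 0" "P \<noteq> 0" "m \<ge> 1"
  shows "9 / 8 + 1 / sqrt 2 \<le> (cmod (1 + of_real m / (2 * P)))\<^sup>2"
proof -
  define \<rho> where "\<rho> = (cmod P)\<^sup>2"
  have "\<rho> > 0" using assms(3) by (simp add: \<rho>_def)
  have "cmod (P\<^sup>2) \<le> cmod (P\<^sup>2 - 1) + cmod 1"
    by (metis diff_add_cancel norm_triangle_ineq)
  then have "\<rho> \<le> 2" using assms(1) by (simp add: \<rho>_def norm_power)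
  have \<rho>: "\<rho> = (Re P)\<^sup>2 + (Im P)\<^sup>2" by (simp add: \<rho>_def cmod_power2)
  have "(cmod (P\<^sup>2 - 1))\<^sup>2 = 1" using assms(1) by simp
  then have "((Re P)\<^sup>2 - (Im P)\<^sup>2 - 1)\<^sup>2 + (2 * Re P * Im P)\<^sup>2 = 1"
    unfolding cmod_power2 by (simp add: power2_eq_square mult_ac)
  then have "\<rho>\<^sup>2 = 2 * ((Re P)\<^sup>2 - (Im P)\<^sup>2)"
    unfolding \<rho> by (simp add: power2_eq_square algebra_simps)
  then have "\<rho>\<^sup>2 \<le> 2 * (Re P)\<^sup>2"
    by (smt (verit) zero_le_power2)
  then have "\<rho> \<le> sqrt 2 * Re P"
    by (intro power2_le_imp_le[of \<rho>]) (use assms(2) in \<open>auto simp: power_mult_distrib\<close>)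
  then have 1: "1 / sqrt 2 \<le> Re P / \<rho>"
    using \<open>\<rho> > 0\<close> by (simp add: field_simps)
  have 2: "1 / 8 \<le> 1 / (4 * \<rho>)"
    using \<open>\<rho> > 0\<close> \<open>\<rho> \<le> 2\<close> by (simp add: field_simps)
  define Q where "Q = 1 / P"
  have Q: "Re Q = Re P / \<rho>" "Im Q = - (Im P / \<rho>)"
    by (simp_all add: Q_def Re_divide Im_divide \<rho>)
  have "1 + of_real m / (2 * P) = 1 + of_real (m / 2) * Q" by (simp add: Q_def)
  then have "(cmod (1 + of_real m / (2 * P)))\<^sup>2 = (1 + m / 2 * (Re P / \<rho>))\<^sup>2 + (m / 2 * (Im P / \<rho>))\<^sup>2"
    unfolding cmod_power2 by (simp only: Q plus_complex.sel times_complex.sel Re_complex_of_real Im_complex_of_real one_complex.sel) simp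
  also have "\<dots> = 1 + m * (Re P / \<rho>) + m\<^sup>2 / 4 * (((Re P)\<^sup>2 + (Im P)\<^sup>2) / \<rho>\<^sup>2)"
    by (simp add: power2_eq_square field_simps add_divide_distrib)
  also have "((Re P)\<^sup>2 + (Im P)\<^sup>2) / \<rho>\<^sup>2 = 1 / \<rho>"
    unfolding \<rho>[symmetric] using \<open>\<rho> > 0\<close> by (simp add: power2_eq_square)
  also have "1 + m * (Re P / \<rho>) + m\<^sup>2 / 4 * (1 / \<rho>) = 1 + m * (Re P / \<rho>) + m\<^sup>2 * (1 / (4 * \<rho>))"
    by simp
  finally have eq: "(cmod (1 + of_real m / (2 * P)))\<^sup>2 = 1 + m * (Re P / \<rho>) + m\<^sup>2 * (1 / (4 * \<rho>))" .
  have "1 * (1 / sqrt 2) \<le> m * (Re P / \<rho>)"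
    using 1 assms(4) by (intro mult_mono) auto
  moreover have "1 * (1 / 8) \<le> m\<^sup>2 * (1 / (4 * \<rho>))"
    using 2 assms(4) by (intro mult_mono) (auto simp: one_le_power)
  ultimately show ?thesis unfolding eq by simp
qed

lemma lemniscate_of_riccati:
  fixes P :: "complex \<Rightarrow> complex" and \<kappa> c :: complex
  assumes hol: "P holomorphic_on ball 0 1" and "P 0 = 1"
    and ode: "\<And>z. cmod z < 1 \<Longrightarrow>
      z * deriv P z + (P z)\<^sup>2 - 1 + (\<kappa> - 2) * (P z - 1) + c * z / 4 = 0"
    and small: "sqrt 3 * cmod (\<kappa> - 2) + cmod c / 4 < sqrt (9 / 8 + 1 / sqrt 2)"
    and z: "cmod z < 1"
  shows "cmod ((P z)\<^sup>2 - 1) < 1 \<and> Re (P z) > 0"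
proof (rule ccontr)
  assume bad: "\<not> ?thesis"
  have cont: "continuous_on (cball 0 (cmod z)) P"
    using hol z by (intro holomorphic_on_imp_continuous_on holomorphic_on_subset[OF hol]) auto
  \<comment> \<open>The points where either condition fails form a closed set. Cutting it down to
    the closed disc through \<open>z\<close> makes it compact, so that a point of least modulus
    exists.\<close>
  define K where "K = {x \<in> cball 0 (cmod z). 1 \<le> cmod ((P x)\<^sup>2 - 1)} \<union> {x \<in> cball 0 (cmod z). Re (P x) \<le> 0}"
  have "closed K"
    unfolding K_def
    by (intro closed_Un continuous_on_closed_Collect_le continuous_intros cont closed_cball)
  then have "compact K"
    unfolding compact_eq_bounded_closed
    by (auto simp: K_def intro: bounded_subset[OF bounded_cball[of 0 "cmod z"]])
  moreover have "z \<in> K" using bad by (auto simp: K_def not_less)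
  ultimately obtain z0 where z0: "z0 \<in> K" "\<And>x. x \<in> K \<Longrightarrow> cmod z0 \<le> cmod x"
    using continuous_attains_inf[of K cmod] by (auto intro: continuous_intros)
  have z0_le: "cmod z0 \<le> cmod z" using z0(1) by (auto simp: K_def)
  with z have z0_1: "cmod z0 < 1" by simp
  have "z0 \<noteq> 0" using z0(1) \<open>P 0 = 1\<close> by (auto simp: K_def)
  define w where "w = (\<lambda>x. (P x)\<^sup>2 - 1)"
  have inside: "cmod (w x) < 1" "Re (P x) > 0" if "cmod x < cmod z0" for x
    using z0(2)[of x] z0_le that by (force simp: K_def w_def)+
  have closure: "z0 \<in> closure (ball 0 (cmod z0))"
    by (subst closure_ball) (use \<open>z0 \<noteq> 0\<close> in auto)
  have contP: "continuous_on (closure (ball 0 (cmod z0))) P"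
    using \<open>z0 \<noteq> 0\<close> z0_le by (intro continuous_on_subset[OF cont]) auto
  have w_le: "cmod (w z0) \<le> 1"
    by (rule continuous_le_on_closure[OF _ closure])
      (auto simp: w_def intro!: continuous_intros contP less_imp_le inside[unfolded w_def])
  have P_ge: "Re (P z0) \<ge> 0"
    by (rule continuous_ge_on_closure[OF _ closure])
      (auto intro!: continuous_intros contP less_imp_le inside)
  \<comment> \<open>Leaving through the imaginary axis is no separate case: there P^2 \<le> 0, so
    |w| = 1 + (Im P)^2, and |w| \<le> 1 leaves only the node P = 0 of the lemniscate.\<close>
  have w_1: "cmod (w z0) = 1"
  proof (cases "Re (P z0) > 0")
    case True
    then show ?thesis using z0(1) w_le by (auto simp: K_def w_def)
  next
    case False
    then have "Re (P z0) = 0" using P_ge by simp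
    then have "(P z0)\<^sup>2 = - of_real ((Im (P z0))\<^sup>2)"
      by (simp add: complex_eq_iff power2_eq_square)
    then have "w z0 = - of_real (1 + (Im (P z0))\<^sup>2)"
      by (simp add: w_def)
    then have "cmod (w z0) = 1 + (Im (P z0))\<^sup>2"
      by (simp only: norm_minus_cancel norm_of_real) simp
    then show ?thesis using w_le by simp
  qed
  have "w holomorphic_on ball 0 1"
    unfolding w_def by (intro holomorphic_intros hol)
  then obtain m where m: "m \<ge> 1" "z0 * deriv w z0 = of_real m * w z0"
    by (rule Jack_lemma[of w "ball 0 1" z0]) (use \<open>P 0 = 1\<close> \<open>z0 \<noteq> 0\<close> z0_1 inside w_1 in \<open>auto simp: w_def\<close>)
  have "(P has_field_derivative deriv P z0) (at z0)"
    using hol z0_1 by (auto intro: holomorphic_derivI)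
  then have "(w has_field_derivative 2 * P z0 * deriv P z0) (at z0)"
    unfolding w_def by (auto intro!: derivative_eq_intros)
  then have dw: "z0 * (2 * P z0 * deriv P z0) = of_real m * w z0"
    using m(2) by (simp add: DERIV_imp_deriv)
  \<comment> \<open>The node is excluded by Jack's lemma: w' = 2 P P' would vanish at
    \<open>z0\<close>, whereas m w is nonzero there.\<close>
  have "P z0 \<noteq> 0"
  proof
    assume "P z0 = 0"
    then have "of_real m * w z0 = 0" using dw by simp
    then show False using m(1) w_1 by auto
  qed
  then have "z0 * deriv P z0 = of_real m * w z0 / (2 * P z0)"
    using dw by (simp add: field_simps)
  \<comment> \<open>Replacing z P' by m w / (2 P) and P^2 - 1 by w turns the Riccati equation into
    this product, whose first factor has modulus 1.\<close>
  then have "w z0 * (1 + of_real m / (2 * P z0)) = - ((\<kappa> - 2) * (P z0 - 1) + c * z0 / 4)"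
    using ode[OF z0_1] by (simp add: w_def algebra_simps add_eq_0_iff)
  then have "cmod (1 + of_real m / (2 * P z0)) = cmod ((\<kappa> - 2) * (P z0 - 1) + c * z0 / 4)"
    using w_1 norm_mult[of "w z0" "1 + of_real m / (2 * P z0)"] by (simp only: norm_minus_cancel mult_1)
  also have "\<dots> \<le> cmod (\<kappa> - 2) * cmod (P z0 - 1) + cmod c * cmod z0 / 4"
    using norm_triangle_ineq[of "(\<kappa> - 2) * (P z0 - 1)" "c * z0 / 4"] by (simp add: norm_mult norm_divide)
  also have "\<dots> \<le> cmod (\<kappa> - 2) * sqrt 3 + cmod c * 1 / 4"
  proof (intro add_mono mult_left_mono divide_right_mono)
    have "(cmod (P z0))\<^sup>2 = cmod (w z0 + 1)"
      by (simp add: w_def norm_power)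
    then have "(cmod (P z0))\<^sup>2 \<le> 2"
      using norm_triangle_ineq[of "w z0" 1] w_1 by simp
    \<comment> \<open>Here |P - 1|^2 = |P|^2 - 2 Re P + 1, with |P|^2 \<le> 2 and Re P \<ge>
      0.\<close>
    then have "(cmod (P z0 - 1))\<^sup>2 \<le> 3"
      using P_ge unfolding cmod_power2 by (simp add: power2_eq_square algebra_simps)
    then show "cmod (P z0 - 1) \<le> sqrt 3"
      by (rule real_le_rsqrt)
  qed (use z0_1 in auto)
  also have "\<dots> < sqrt (9 / 8 + 1 / sqrt 2)"
    using small by (simp add: mult.commute)
  finally have "cmod (1 + of_real m / (2 * P z0)) < sqrt (9 / 8 + 1 / sqrt 2)" .
  moreover have "sqrt (9 / 8 + 1 / sqrt 2) \<le> cmod (1 + of_real m / (2 * P z0))"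
    using lemniscate_boundary_bound[OF w_1[unfolded w_def] P_ge \<open>P z0 \<noteq> 0\<close> m(1)]
    by (rule real_le_lsqrt[OF norm_ge_zero])
  ultimately show False by linarith
qed

section \<open>Power series dominated by the exponential series\<close>

lemma norm_coeff_le_of_ratio:
  fixes a :: "nat \<Rightarrow> complex"
  assumes "\<And>n. real (Suc n) * cmod (a (Suc n)) \<le> B * cmod (a n)" "B \<ge> 0"
  shows "cmod (a n) \<le> cmod (a 0) * (B ^ n / fact n)"
proof (induction n)
  case (Suc n)
  have "real (Suc n) * cmod (a (Suc n)) \<le> B * (cmod (a 0) * (B ^ n / fact n))"
    using assms(1)[of n] mult_left_mono[OF Suc assms(2)] by linarith
  then show ?case by (simp add: field_simps del: of_nat_Suc)
qed simp

lemma sums_exp_real: "(\<lambda>n. M * (x ^ n / fact n)) sums (M * exp x)" for M x :: real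
  using sums_mult[OF exp_converges[of x], of M] by (simp add: scaleR_conv_of_real divide_inverse mult.commute)

lemma summable_of_ratio:
  fixes a :: "nat \<Rightarrow> complex"
  assumes "\<And>n. real (Suc n) * cmod (a (Suc n)) \<le> B * cmod (a n)" "B \<ge> 0"
  shows "summable (\<lambda>n. a n * z ^ n)"
proof (rule summable_comparison_test')
  show "summable (\<lambda>n. cmod (a 0) * ((B * cmod z) ^ n / fact n))"
    using sums_exp_real by (rule sums_summable)
  show "norm (a n * z ^ n) \<le> cmod (a 0) * ((B * cmod z) ^ n / fact n)" for n
    using mult_right_mono[OF norm_coeff_le_of_ratio[OF assms, of n], of "cmod z ^ n"]
    by (simp add: norm_mult norm_power power_mult_distrib mult.assoc)
qed

text \<open>On the closed unit disc the terms after the constant one sum to at most |a 0| (exp B -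
  1) in modulus, which is less than |a 0|, so they cannot cancel the constant term.\<close>

lemma power_series_neq_0_of_ratio:
  fixes a :: "nat \<Rightarrow> complex"
  assumes ratio: "\<And>n. real (Suc n) * cmod (a (Suc n)) \<le> B * cmod (a n)" and B: "B \<ge> 0" "exp B < 2"
    and "a 0 \<noteq> 0" "cmod z \<le> 1"
  shows "(\<Sum>n. a n * z ^ n) \<noteq> 0"
proof
  assume 0: "(\<Sum>n. a n * z ^ n) = 0"
  have "(\<lambda>n. a (Suc n) * z ^ Suc n) sums (- a 0)"
    using summable_sums[OF summable_of_ratio[OF ratio B(1)], of z] 0
    by (subst sums_Suc_iff) simp
  then have eq: "(\<Sum>n. a (Suc n) * z ^ Suc n) = - a 0"
    by (rule sums_unique[symmetric])
  have S: "(\<lambda>n. cmod (a 0) * (B ^ Suc n / fact (Suc n))) sums (cmod (a 0) * exp B - cmod (a 0))"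
    using sums_exp_real[of "cmod (a 0)" B] by (subst sums_Suc_iff) simp
  have "norm (a (Suc n) * z ^ Suc n) \<le> cmod (a 0) * (B ^ Suc n / fact (Suc n))" for n
  proof -
    have "norm (a (Suc n) * z ^ Suc n) \<le> cmod (a (Suc n)) * 1"
      unfolding norm_mult norm_power using assms(5) by (intro mult_left_mono power_le_one) auto
    also note norm_coeff_le_of_ratio[OF ratio B(1), of "Suc n"]
    finally show ?thesis by simp
  qed
  from norm_suminf_le[OF this sums_summable[OF S]]
  have "norm (\<Sum>n. a (Suc n) * z ^ Suc n) \<le> cmod (a 0) * exp B - cmod (a 0)"
    unfolding sums_unique[OF S, symmetric] .
  then have "cmod (a 0) * 2 \<le> cmod (a 0) * exp B"
    unfolding eq by simp
  then show False using B(2) \<open>a 0 \<noteq> 0\<close> by simp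
qed

text \<open>The value 34/25 equals (17/10) (4/5). With 17/10 as a lower bound for sqrt 3, the
  smallness hypothesis then yields |\<kappa> - 2| \<le> 4/5 by linear arithmetic.\<close>

lemma sqrt_9_8_plus_inverse_sqrt_2_le: "sqrt (9 / 8 + 1 / sqrt 2) \<le> (34 / 25 :: real)"
proof -
  have "sqrt 2 \<ge> (7 / 5 :: real)"
    by (rule real_le_rsqrt) (simp add: power2_eq_square)
  then have "1 / sqrt 2 \<le> 1 / (7 / 5 ::real)" by (intro divide_left_mono) auto
  then show ?thesis
    by (intro real_le_lsqrt) (auto simp: power2_eq_square)
qed

text \<open>The function w = P^2 - 1 witnesses the subordination: it maps into the unit disc and
  vanishes at 0, and Re P > 0 selects the principal root, so that P = csqrt (1 + w).\<close>

lemma lemniscate_convexI: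
  assumes "f analytic_on unit_disc" "\<And>z. z \<in> unit_disc \<Longrightarrow> deriv f z \<noteq> 0"
    and hol: "(\<lambda>z. 1 + z * deriv (deriv f) z / deriv f z) holomorphic_on unit_disc"
    and lem: "\<And>z. z \<in> unit_disc \<Longrightarrow> cmod ((1 + z * deriv (deriv f) z / deriv f z)\<^sup>2 - 1) < 1 \<and>
                  Re (1 + z * deriv (deriv f) z / deriv f z) > 0"
  shows "lemniscate_convex f"
proof -
  define P where "P = (\<lambda>z. 1 + z * deriv (deriv f) z / deriv f z)"
  have P: "P holomorphic_on unit_disc" using hol by (simp add: P_def)
  have "(\<lambda>z. csqrt (1 + z)) holomorphic_on unit_disc"
  proof (rule holomorphic_on_csqrt')
    show "(+) 1 holomorphic_on unit_disc" by (intro holomorphic_intros)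
    fix z :: complex assume "z \<in> unit_disc"
    then have "Re (1 + z) > 0" using abs_Re_le_cmod[of z] by simp
    then show "1 + z \<notin> \<real>\<^sub>\<le>\<^sub>0" by (auto simp: complex_nonpos_Reals_iff)
  qed
  moreover have "(\<lambda>z. (P z)\<^sup>2 - 1) holomorphic_on unit_disc"
    by (intro holomorphic_intros P)
  moreover have "P z = csqrt (1 + ((P z)\<^sup>2 - 1))" if "z \<in> unit_disc" for z
    using lem[OF that] by (intro csqrt_unique[symmetric]) (auto simp: P_def)
  ultimately have "subordinate P (\<lambda>z. csqrt (1 + z))"
    unfolding subordinate_def analytic_on_open[OF open_ball]
    by (intro conjI exI[of _ "\<lambda>z. (P z)\<^sup>2 - 1"] ballI) (use lem P in \<open>auto simp: P_def\<close>)
  then show ?thesis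
    unfolding lemniscate_convex_def using assms(1,2) P by (simp add: analytic_on_open P_def)
qed

section \<open>The generalized Bessel function\<close>

theorem theorem2p2:
  fixes b p c \<kappa> :: complex
  assumes "c \<noteq> 0"
    and "\<kappa> = p + (b + 1) / 2"
    and "sqrt 3 * cmod (\<kappa> - 2) + cmod c / 4 < sqrt (9 / 8 + 1 / sqrt 2)"
  shows "lemniscate_convex (gen_bessel p b c)"
proof -
  have "17 / 10 * cmod (\<kappa> - 2) \<le> sqrt 3 * cmod (\<kappa> - 2)"
    by (intro mult_right_mono real_le_rsqrt) (auto simp: power2_eq_square)
  with assms(3) sqrt_9_8_plus_inverse_sqrt_2_le
  have "17 / 10 * cmod (\<kappa> - 2) + cmod c / 4 < 34 / 25"
    by linarith
  moreover have "cmod c / 4 \<ge> 0" "cmod (\<kappa> - 2) \<ge> 0"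
    by simp_all
  ultimately have "cmod c / 4 < 34 / 25 \<and> cmod (\<kappa> - 2) \<le> 4 / 5"
    by argo
  then have c_less: "cmod c / 4 < 34 / 25" and "cmod (\<kappa> - 2) \<le> 4 / 5"
    by blast+
  then have "Re \<kappa> \<ge> 6 / 5"
    using abs_Re_le_cmod[of "\<kappa> - 2"] by simp
  \<comment> \<open>In particular no Pochhammer symbol of \<kappa> vanishes, so the series is the
    intended one.\<close>
  have \<kappa>_ge: "cmod (\<kappa> + of_nat n) \<ge> 6 / 5 + real n" for n
    using complex_Re_le_cmod[of "\<kappa> + of_nat n"] \<open>Re \<kappa> \<ge> 6 / 5\<close> by simp
  have \<kappa>_nz: "\<kappa> + of_nat n \<noteq> 0" for n
    using \<kappa>_ge[of n] by auto

  define a where "a = (\<lambda>n. (- c / 4) ^ n / pochhammer \<kappa> n / fact n)"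
  have poch: "pochhammer \<kappa> n \<noteq> 0" for n
    using \<kappa>_nz by (simp add: pochhammer_prod)
  have a_rec: "of_nat (Suc n) * (\<kappa> + of_nat n) * a (Suc n) = - c / 4 * a n" for n
    using \<kappa>_nz[of n] poch[of n] by (simp add: a_def pochhammer_Suc divide_simps del: of_nat_Suc)
  \<comment> \<open>These are the coefficients of u'. Passing from \<open>a\<close> to
    \<open>d\<close> replaces \<kappa> by \<kappa> + 1 in the recurrence.\<close>
  define d where "d = diffs a"
  have d: "d n = of_nat (Suc n) * a (Suc n)" for n
    by (simp add: d_def diffs_def)
  have d_rec: "of_nat (Suc n) * (\<kappa> + of_nat (Suc n)) * d (Suc n) = - c / 4 * d n" for n
    using arg_cong[OF a_rec[of "Suc n"], of "\<lambda>x. of_nat (Suc n) * x"] unfolding d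
    by (simp only: mult_ac)
  \<comment> \<open>This is where c \<noteq> 0 enters: u'(0) = -c / (4 \<kappa>).\<close>
  have "d 0 \<noteq> 0"
    using \<open>c \<noteq> 0\<close> \<kappa>_nz[of 0] by (simp add: d a_def)
  \<comment> \<open>The constant 11/5 is 6/5 + 1, a lower bound for |\<kappa> + n + 1|. The shift by
    one matters: dividing 34/25 by 6/5 alone would give a bound above ln 2.\<close>
  have d_ratio: "real (Suc n) * cmod (d (Suc n)) \<le> cmod c / 4 / (11 / 5) * cmod (d n)" for n
  proof -
    have "real (Suc n) * (11 / 5) * cmod (d (Suc n)) \<le> real (Suc n) * cmod (\<kappa> + of_nat (Suc n)) * cmod (d (Suc n))"
      using \<kappa>_ge[of "Suc n"] by (intro mult_right_mono mult_left_mono) auto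
    also have "\<dots> = cmod c / 4 * cmod (d n)"
      using arg_cong[OF d_rec[of n], of cmod] by (simp only: norm_mult norm_of_nat norm_divide norm_minus_cancel norm_numeral)
    finally show ?thesis by (simp add: algebra_simps)
  qed
  have a_ratio: "real (Suc n) * cmod (a (Suc n)) \<le> cmod c / 4 * cmod (a n)" for n
  proof -
    have "real (Suc n) * 1 * cmod (a (Suc n)) \<le> real (Suc n) * cmod (\<kappa> + of_nat n) * cmod (a (Suc n))"
      using \<kappa>_ge[of n] by (intro mult_right_mono mult_left_mono) auto
    also have "\<dots> = cmod c / 4 * cmod (a n)"
      using arg_cong[OF a_rec[of n], of cmod] by (simp only: norm_mult norm_of_nat norm_divide norm_minus_cancel norm_numeral)
    finally show ?thesis by simp
  qed

  define ps :: "(nat \<Rightarrow> complex) \<Rightarrow> complex \<Rightarrow> complex" where "ps = (\<lambda>e z. \<Sum>n. e n * z ^ n)"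
  have summ_a: "summable (\<lambda>n. a n * z ^ n)" for z
    by (rule summable_of_ratio[OF a_ratio]) simp
  have summ_d: "summable (\<lambda>n. d n * z ^ n)" for z
    unfolding d_def by (rule termdiff_converges_all[OF summ_a])
  have summ_d': "summable (\<lambda>n. diffs d n * z ^ n)" for z
    by (rule termdiff_converges_all[OF summ_d])
  have summ_d'': "summable (\<lambda>n. diffs (diffs d) n * z ^ n)" for z
    by (rule termdiff_converges_all[OF summ_d'])
  have u: "gen_bessel p b c = ps a"
    by (simp add: fun_eq_iff gen_bessel_def ps_def a_def assms(2))
  have D: "(ps a has_field_derivative ps d z) (at z)" "(ps d has_field_derivative ps (diffs d) z) (at z)"
    "(ps (diffs d) has_field_derivative ps (diffs (diffs d)) z) (at z)" for z
    unfolding ps_def d_def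
    by (rule termdiffs_strong_converges_everywhere summ_a summ_d[unfolded d_def] summ_d'[unfolded d_def])+
  then have derivs: "deriv (ps a) = ps d" "deriv (ps d) = ps (diffs d)"
    by (auto simp: fun_eq_iff intro: DERIV_imp_deriv)
  have nz: "ps d z \<noteq> 0" if "cmod z < 1" for z
    unfolding ps_def
  proof (rule power_series_neq_0_of_ratio[OF d_ratio])
    \<comment> \<open>Numerically (34/25) / (11/5) = 34/55, which is below 2/3 and hence below ln
      2.\<close>
    have "cmod c / 4 / (11 / 5) < 2 / 3" using c_less by simp
    then have "cmod c / 4 / (11 / 5) < ln 2" using ln2_ge_two_thirds by linarith
    then have "exp (cmod c / 4 / (11 / 5)) < exp (ln 2)" by (simp only: exp_less_mono)
    then show "exp (cmod c / 4 / (11 / 5)) < 2" by simp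
  qed (use that \<open>d 0 \<noteq> 0\<close> in auto)
  \<comment> \<open>This is the derivative of z u'' + \<kappa> u' + (c/4) u = 0. Comparing
    coefficients of z^n reduces it to \<open>d_rec\<close>.\<close>
  have bessel: "z * ps (diffs (diffs d)) z + (\<kappa> + 1) * ps (diffs d) z + c / 4 * ps d z = 0" for z
  proof -
    have "(\<lambda>n. of_nat n * diffs d n * z ^ n) sums (z * ps (diffs (diffs d)) z)"
    proof -
      have "(\<lambda>n. z * (diffs (diffs d) n * z ^ n)) sums (z * ps (diffs (diffs d)) z)"
        unfolding ps_def by (intro sums_mult summable_sums summ_d'')
      then have "(\<lambda>n. of_nat (Suc n) * diffs d (Suc n) * z ^ Suc n) sums (z * ps (diffs (diffs d)) z)"
        by (simp add: diffs_def mult_ac)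
      \<comment> \<open>The index shift adds only the term for n = 0, which is zero because of the
        factor n.\<close>
      then show ?thesis by (subst (asm) sums_Suc_iff) simp
    qed
    moreover have "(\<lambda>n. (\<kappa> + 1) * (diffs d n * z ^ n)) sums ((\<kappa> + 1) * ps (diffs d) z)"
      "(\<lambda>n. c / 4 * (d n * z ^ n)) sums (c / 4 * ps d z)"
      unfolding ps_def by (intro sums_mult summable_sums summ_d summ_d')+
    ultimately have "(\<lambda>n. of_nat n * diffs d n * z ^ n + (\<kappa> + 1) * (diffs d n * z ^ n) + c / 4 * (d n * z ^ n))
       sums (z * ps (diffs (diffs d)) z + (\<kappa> + 1) * ps (diffs d) z + c / 4 * ps d z)"
      by (intro sums_add)
    moreover have "of_nat n * diffs d n * z ^ n + (\<kappa> + 1) * (diffs d n * z ^ n) + c / 4 * (d n * z ^ n) = 0" for n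
    proof -
      have "of_nat n * diffs d n * z ^ n + (\<kappa> + 1) * (diffs d n * z ^ n) + c / 4 * (d n * z ^ n) =
        (of_nat (Suc n) * (\<kappa> + of_nat (Suc n)) * d (Suc n) - (- c / 4 * d n)) * z ^ n"
        by (simp add: diffs_def algebra_simps)
      then show ?thesis unfolding d_rec by simp
    qed
    ultimately have "(\<lambda>n. 0) sums (z * ps (diffs (diffs d)) z + (\<kappa> + 1) * ps (diffs d) z + c / 4 * ps d z)"
      by (simp only:)
    then show ?thesis by (rule sums_unique2[OF _ sums_zero])
  qed

  define P where "P = (\<lambda>z. 1 + z * ps (diffs d) z / ps d z)"
  have dP: "(P has_field_derivative ps (diffs d) z / ps d z + z * (ps (diffs (diffs d)) z / ps d z)
      - z * (ps (diffs d) z / ps d z)\<^sup>2) (at z)" if "cmod z < 1" for z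
    unfolding P_def
    by (rule derivative_eq_intros D(2,3) refl nz that)+
      (simp add: nz[OF that] diff_divide_distrib add_divide_distrib power2_eq_square mult_ac)
  have hol: "P holomorphic_on unit_disc"
    unfolding holomorphic_on_open[OF open_ball] using dP by fastforce
  have "cmod ((P z)\<^sup>2 - 1) < 1 \<and> Re (P z) > 0" if "cmod z < 1" for z
  proof (rule lemniscate_of_riccati[OF hol _ _ assms(3) that])
    show "P 0 = 1" by (simp add: P_def)
    fix z :: complex assume z: "cmod z < 1"
    \<comment> \<open>In these quotients P' = q + z r - z q^2. The q^2 terms of z P' and P^2 cancel,
      which leaves z times the third-order equation divided by u'.\<close>
    define q r where "q = ps (diffs d) z / ps d z" and "r = ps (diffs (diffs d)) z / ps d z"
    have Pz: "P z = 1 + z * q" by (simp add: P_def q_def)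
    have "z * deriv P z + (P z)\<^sup>2 - 1 + (\<kappa> - 2) * (P z - 1) + c * z / 4 =
      z * (z * r + (\<kappa> + 1) * q + c / 4)"
      unfolding DERIV_imp_deriv[OF dP[OF z]] q_def[symmetric] r_def[symmetric] Pz
      by (simp add: algebra_simps power2_eq_square)
    also have "z * r + (\<kappa> + 1) * q + c / 4 =
        (z * ps (diffs (diffs d)) z + (\<kappa> + 1) * ps (diffs d) z + c / 4 * ps d z) / ps d z"
      using nz[OF z] by (simp add: q_def r_def add_divide_distrib)
    also have "z * \<dots> = 0"
      unfolding bessel by simp
    finally show "z * deriv P z + (P z)\<^sup>2 - 1 + (\<kappa> - 2) * (P z - 1) + c * z / 4 = 0" .
  qed
  moreover have "ps a analytic_on unit_disc"
    using D(1) by (auto simp: analytic_on_open holomorphic_on_open)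
  ultimately show ?thesis
    unfolding u using nz hol by (intro lemniscate_convexI; simp only: derivs P_def mem_ball_0)
qed

end
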